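(* Let $X$ be a nonempty set and $S:X\times X\to X\times X$ a map, written $S(x,y)=(g_x(y),f_y(x))$. (a) Suppose that $S^2=\mathrm{id}$, that the maps $f_x:X\to X$ are invertible, and that the assignment $x\mapsto f_x$ is a right action of $G_X$ on $X$. Define $T:X\to X$ by $T(y)=f_y^{-1}(y)$. Then $f_x^{-1}T=Tg_x$ for all $x\in X$. Suppose in addition that the maps $g_x$ are invertible, so that $(X,S)$ is nondegenerate and involutive. Then: (b) The map $T$ is invertible. Thus the left actions of $G_X$ on $X$ given by $x\mapsto f_x^{-1}$ and by $x\mapsto g_x$ are isomorphic to each other. (c) For nondegenerate involutive $(X,S)$, the condition that $x\mapsto f_x$ is a right action of $G_X$ on $X$ implies that $x\mapsto g_x$ is a left action of $G_X$ on $X$, and that the linking relation $$f_{g_{f_y(x)}(z)}(g_x(y))=g_{f_{g_y(z)}(x)}(f_z(y))$$ holds for all $x,y,z\in X$. Thus a nondegenerate involutive pair $(X,S)$ is a symmetric set if and only if the assignment $x\mapsto f_x$ is a right action of $G_X$ on $X$.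
   Context: For a set $X$ and a map $S:X^2\to X^2$, the structure group $G_X$ is the group generated by the elements of $X$ with defining relations $xy=tz$ whenever $S(x,y)=(t,z)$. Thus, for bijective $f_x$, "$x\mapsto f_x$ is a right action of $G_X$" means $f_yf_x=f_zf_t$ whenever $S(x,y)=(t,z)$ (equivalently $x\mapsto f_x^{-1}$ is a left action), and "$x\mapsto g_x$ is a left action" means $g_xg_y=g_tg_z$ whenever $S(x,y)=(t,z)$. $(X,S)$ is nondegenerate if all maps $f_y$ and $g_x$ are bijections of $X$; involutive if $S^2=\mathrm{id}$; braided if $S^{12}S^{23}S^{12}=S^{23}S^{12}S^{23}$ on $X^3$ (with $S^{12}=S\times\mathrm{id}$, $S^{23}=\mathrm{id}\times S$); symmetric if braided and involutive. *)

theory Defs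
  imports "HOL-Algebra.Group_Action"
begin

text \<open>
  The set \<open>X\<close> is the type \<open>'a\<close> (types are nonempty). A map \<open>S\<close> on \<open>X \<times> X\<close> is written
  \<open>S (x, y) = (g x y, f y x)\<close>, so \<open>g x\<close> is the first component as a function of \<open>y\<close> and \<open>f y\<close>
  is the second component as a function of \<open>x\<close>.
\<close>

definition nondegenerate :: "('a \<times> 'a \<Rightarrow> 'a \<times> 'a) \<Rightarrow> bool" where
  "nondegenerate S \<longleftrightarrow> (\<forall>y. bij (\<lambda>x. snd (S (x, y)))) \<and> (\<forall>x. bij (\<lambda>y. fst (S (x, y))))"

definition involutive :: "('a \<times> 'a \<Rightarrow> 'a \<times> 'a) \<Rightarrow> bool" where
  "involutive S \<longleftrightarrow> S \<circ> S = id"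

definition S12 :: "('a \<times> 'a \<Rightarrow> 'a \<times> 'a) \<Rightarrow> 'a \<times> 'a \<times> 'a \<Rightarrow> 'a \<times> 'a \<times> 'a" where
  "S12 S = (\<lambda>(x, y, z). (fst (S (x, y)), snd (S (x, y)), z))"

definition S23 :: "('a \<times> 'a \<Rightarrow> 'a \<times> 'a) \<Rightarrow> 'a \<times> 'a \<times> 'a \<Rightarrow> 'a \<times> 'a \<times> 'a" where
  "S23 S = (\<lambda>(x, y, z). (x, S (y, z)))"

definition braided :: "('a \<times> 'a \<Rightarrow> 'a \<times> 'a) \<Rightarrow> bool" where
  "braided S \<longleftrightarrow> S12 S \<circ> S23 S \<circ> S12 S = S23 S \<circ> S12 S \<circ> S23 S"

definition symmetric_set :: "('a \<times> 'a \<Rightarrow> 'a \<times> 'a) \<Rightarrow> bool" where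
  "symmetric_set S \<longleftrightarrow> braided S \<and> involutive S"

text \<open>
  The structure group: words in the letters \<open>(x, True)\<close>, standing for \<open>x\<close>, and \<open>(x, False)\<close>,
  standing for the inverse of \<open>x\<close>, modulo the congruence generated by free cancellation and the
  relations \<open>x y = t z\<close> for \<open>S (x, y) = (t, z)\<close>.
\<close>

inductive word_eq ::
  "('a \<times> 'a \<Rightarrow> 'a \<times> 'a) \<Rightarrow> ('a \<times> bool) list \<Rightarrow> ('a \<times> bool) list \<Rightarrow> bool"
  for S where
  refl: "word_eq S u u"
| sym: "word_eq S u v \<Longrightarrow> word_eq S v u"
| trans: "word_eq S u v \<Longrightarrow> word_eq S v w \<Longrightarrow> word_eq S u w"
| append: "word_eq S u u' \<Longrightarrow> word_eq S v v' \<Longrightarrow> word_eq S (u @ v) (u' @ v')"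
| cancel: "word_eq S [(x, b), (x, \<not> b)] []"
| rel: "S (x, y) = (t, z) \<Longrightarrow> word_eq S [(x, True), (y, True)] [(t, True), (z, True)]"

definition word_class ::
  "('a \<times> 'a \<Rightarrow> 'a \<times> 'a) \<Rightarrow> ('a \<times> bool) list \<Rightarrow> ('a \<times> bool) list set" where
  "word_class S u = {v. word_eq S u v}"

definition structure_group ::
  "('a \<times> 'a \<Rightarrow> 'a \<times> 'a) \<Rightarrow> ('a \<times> bool) list set monoid" where
  "structure_group S =
    \<lparr>carrier = range (word_class S),
     mult = (\<lambda>A B. {w. \<exists>u\<in>A. \<exists>v\<in>B. word_eq S (u @ v) w}),
     one = word_class S []\<rparr>"

definition generator :: "('a \<times> 'a \<Rightarrow> 'a \<times> 'a) \<Rightarrow> 'a \<Rightarrow> ('a \<times> bool) list set" where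
  "generator S x = word_class S [(x, True)]"

text \<open>
  An assignment \<open>x \<mapsto> h x\<close> of permutations is called a left (right) action of the structure group
  if it respects the defining relations; lemmas \<open>left_action_iff\<close> and \<open>right_action_iff\<close> below
  relate this to actions of the group \<open>structure_group S\<close>. The maps act on the left of their
  arguments throughout, hence the reversed order of composition for right actions.
\<close>

definition is_left_action :: "('a \<times> 'a \<Rightarrow> 'a \<times> 'a) \<Rightarrow> ('a \<Rightarrow> 'a \<Rightarrow> 'a) \<Rightarrow> bool" where
  "is_left_action S h \<longleftrightarrow> (\<forall>x. bij (h x)) \<and>
     (\<forall>x y t z. S (x, y) = (t, z) \<longrightarrow> h x \<circ> h y = h t \<circ> h z)"

definition is_right_action :: "('a \<times> 'a \<Rightarrow> 'a \<times> 'a) \<Rightarrow> ('a \<Rightarrow> 'a \<Rightarrow> 'a) \<Rightarrow> bool" where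
  "is_right_action S h \<longleftrightarrow> (\<forall>x. bij (h x)) \<and>
     (\<forall>x y t z. S (x, y) = (t, z) \<longrightarrow> h y \<circ> h x = h z \<circ> h t)"

definition extends_to_action ::
  "('a \<times> 'a \<Rightarrow> 'a \<times> 'a) \<Rightarrow> ('a \<Rightarrow> 'a \<Rightarrow> 'a) \<Rightarrow> (('a \<times> bool) list set \<Rightarrow> 'a \<Rightarrow> 'a) \<Rightarrow> bool" where
  "extends_to_action S h \<phi> \<longleftrightarrow>
     group_action (structure_group S) UNIV \<phi> \<and> (\<forall>x. \<phi> (generator S x) = h x)"

definition isomorphic_actions ::
  "('g, 'm) monoid_scheme \<Rightarrow> 'e set \<Rightarrow> ('g \<Rightarrow> 'e \<Rightarrow> 'e) \<Rightarrow> 'f set \<Rightarrow> ('g \<Rightarrow> 'f \<Rightarrow> 'f) \<Rightarrow> bool" where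
  "isomorphic_actions G E \<phi> F \<psi> \<longleftrightarrow>
     (\<exists>t. bij_betw t E F \<and> (\<forall>a\<in>carrier G. \<forall>e\<in>E. t (\<phi> a e) = \<psi> a (t e)))"

lemma word_class_eq_iff: "word_class S u = word_class S v \<longleftrightarrow> word_eq S u v"
  unfolding word_class_def by (auto intro: word_eq.intros)

lemma word_class_mult:
  "word_class S u \<otimes>\<^bsub>structure_group S\<^esub> word_class S v = word_class S (u @ v)"
proof -
  have "word_eq S (u @ v) w" if "word_eq S u u'" "word_eq S v v'" "word_eq S (u' @ v') w" for u' v' w
    using that by (meson word_eq.append word_eq.trans)
  then show ?thesis
    unfolding structure_group_def word_class_def by (auto intro: word_eq.refl)
qed

lemma structure_group_carrier: "carrier (structure_group S) = range (word_class S)"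
  by (simp add: structure_group_def)

lemma structure_group_one: "\<one>\<^bsub>structure_group S\<^esub> = word_class S []"
  by (simp add: structure_group_def)

definition inverse_word :: "('a \<times> bool) list \<Rightarrow> ('a \<times> bool) list" where
  "inverse_word w = rev (map (\<lambda>(x, b). (x, \<not> b)) w)"

lemma inverse_word_left: "word_eq S (inverse_word w @ w) []"
proof (induction w)
  case Nil
  show ?case by (simp add: inverse_word_def word_eq.refl)
next
  case (Cons p w)
  obtain x b where p: "p = (x, b)" by force
  have "word_eq S ([(x, \<not> b), (x, \<not> \<not> b)] @ w) ([] @ w)"
    by (rule word_eq.append[OF word_eq.cancel word_eq.refl])
  then have "word_eq S (inverse_word w @ ([(x, \<not> b), (x, b)] @ w)) (inverse_word w @ w)"
    by (auto intro: word_eq.append word_eq.refl)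
  with Cons.IH have "word_eq S (inverse_word w @ ([(x, \<not> b), (x, b)] @ w)) []"
    by (rule word_eq.trans[rotated])
  then show ?case by (simp add: inverse_word_def p)
qed

lemma group_structure_group: "group (structure_group S)"
proof (rule groupI)
  fix a assume "a \<in> carrier (structure_group S)"
  then obtain w where w: "a = word_class S w" by (auto simp: structure_group_carrier)
  have "word_class S (inverse_word w) \<otimes>\<^bsub>structure_group S\<^esub> a = \<one>\<^bsub>structure_group S\<^esub>"
    by (simp add: w word_class_mult structure_group_one word_class_eq_iff inverse_word_left)
  then show "\<exists>b\<in>carrier (structure_group S). b \<otimes>\<^bsub>structure_group S\<^esub> a = \<one>\<^bsub>structure_group S\<^esub>"
    by (auto simp: structure_group_carrier)
qed (auto simp: structure_group_carrier structure_group_one word_class_mult)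

primrec eval_word :: "('a \<Rightarrow> 'a \<Rightarrow> 'a) \<Rightarrow> ('a \<times> bool) list \<Rightarrow> 'a \<Rightarrow> 'a" where
  "eval_word h [] = id"
| "eval_word h (p # w) =
     (if snd p then h (fst p) else inv_into UNIV (h (fst p))) \<circ> eval_word h w"

lemma eval_word_append: "eval_word h (u @ v) = eval_word h u \<circ> eval_word h v"
  by (induction u) (auto simp: o_assoc)

lemma bij_eval_word: "(\<And>x. bij (h x)) \<Longrightarrow> bij (eval_word h w)"
  by (induction w) (auto intro!: bij_comp bij_imp_bij_inv bij_id[unfolded id_def[symmetric]])

lemma eval_word_eq:
  assumes "is_left_action S h" "word_eq S u v"
  shows "eval_word h u = eval_word h v"
  using assms(2)
proof induction
  case (cancel x b)
  have "bij (h x)" using assms(1) by (simp add: is_left_action_def)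
  then show ?case
    by (cases b) (auto simp: fun_eq_iff bij_is_inj bij_is_surj surj_f_inv_f inv_f_f)
next
  case (rel x y t z)
  then show ?case using assms(1) by (simp add: is_left_action_def)
qed (auto simp: eval_word_append)

lemma left_action_iff:
  assumes "\<And>x. bij (h x)"
  shows "is_left_action S h \<longleftrightarrow> (\<exists>\<phi>. extends_to_action S h \<phi>)"
proof
  assume L: "is_left_action S h"
  define \<phi> where "\<phi> = (\<lambda>a. eval_word h (SOME w. a = word_class S w))"
  have \<phi>: "\<phi> (word_class S w) = eval_word h w" for w
  proof -
    have "word_class S w = word_class S (SOME v. word_class S w = word_class S v)"
      by (rule someI[of "\<lambda>v. word_class S w = word_class S v"]) simp
    then have "word_eq S w (SOME v. word_class S w = word_class S v)"
      by (simp only: word_class_eq_iff)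
    from eval_word_eq[OF L this] show ?thesis by (simp add: \<phi>_def)
  qed
  have "\<phi> \<in> hom (structure_group S) (BijGroup UNIV)"
  proof (rule homI)
    fix a assume "a \<in> carrier (structure_group S)"
    then show "\<phi> a \<in> carrier (BijGroup UNIV)"
      using bij_eval_word[OF assms] by (auto simp: structure_group_carrier \<phi> BijGroup_def Bij_def)
  next
    fix a b assume "a \<in> carrier (structure_group S)" "b \<in> carrier (structure_group S)"
    then show "\<phi> (a \<otimes>\<^bsub>structure_group S\<^esub> b) = \<phi> a \<otimes>\<^bsub>BijGroup UNIV\<^esub> \<phi> b"
      using bij_eval_word[OF assms]
      by (auto simp: structure_group_carrier word_class_mult \<phi> BijGroup_def Bij_def
          eval_word_append compose_def fun_eq_iff)
  qed
  then have "group_action (structure_group S) UNIV \<phi>"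
    by (simp add: group_action_def group_hom_def group_hom_axioms_def group_structure_group
        group_BijGroup)
  moreover have "\<phi> (generator S x) = h x" for x
    by (simp add: generator_def \<phi>)
  ultimately show "\<exists>\<phi>. extends_to_action S h \<phi>"
    unfolding extends_to_action_def by blast
next
  assume "\<exists>\<phi>. extends_to_action S h \<phi>"
  then obtain \<phi> where \<phi>: "group_action (structure_group S) UNIV \<phi>" "\<And>x. \<phi> (generator S x) = h x"
    unfolding extends_to_action_def by blast
  have hom: "\<phi> \<in> hom (structure_group S) (BijGroup UNIV)"
    using \<phi>(1) by (simp add: group_action_def group_hom_def group_hom_axioms_def)
  have two: "\<phi> (word_class S [(x, True), (y, True)]) = h x \<circ> h y" for x y
  proof -
    have "\<phi> (generator S x \<otimes>\<^bsub>structure_group S\<^esub> generator S y) = h x \<otimes>\<^bsub>BijGroup UNIV\<^esub> h y"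
      using hom_mult[OF hom, of "generator S x" "generator S y"]
      by (simp add: \<phi>(2)) (simp add: generator_def structure_group_carrier)
    then show ?thesis
      using assms by (simp add: generator_def word_class_mult BijGroup_def Bij_def compose_def fun_eq_iff)
  qed
  have "h x \<circ> h y = h t \<circ> h z" if "S (x, y) = (t, z)" for x y t z
  proof -
    have "word_class S [(x, True), (y, True)] = word_class S [(t, True), (z, True)]"
      using that by (simp add: word_class_eq_iff word_eq.rel)
    then show ?thesis using two by metis
  qed
  then show "is_left_action S h" using assms by (simp add: is_left_action_def)
qed

lemma right_action_iff_left_inverse:
  assumes "\<And>x. bij (h x)"
  shows "is_right_action S h \<longleftrightarrow> is_left_action S (\<lambda>x. inv_into UNIV (h x))"
proof -
  have "h y \<circ> h x = h z \<circ> h t \<longleftrightarrow>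
      inv_into UNIV (h x) \<circ> inv_into UNIV (h y) = inv_into UNIV (h t) \<circ> inv_into UNIV (h z)"
    for x y t z
  proof -
    have b: "bij (h y \<circ> h x)" "bij (h z \<circ> h t)" using assms by (auto intro: bij_comp)
    have "h y \<circ> h x = h z \<circ> h t \<longleftrightarrow> inv_into UNIV (h y \<circ> h x) = inv_into UNIV (h z \<circ> h t)"
      using b by (metis inv_inv_eq)
    then show ?thesis using assms by (simp add: o_inv_distrib)
  qed
  then show ?thesis
    using assms by (simp add: is_right_action_def is_left_action_def bij_imp_bij_inv)
qed

lemma right_action_iff:
  assumes "\<And>x. bij (h x)"
  shows "is_right_action S h \<longleftrightarrow> (\<exists>\<phi>. extends_to_action S (\<lambda>x. inv_into UNIV (h x)) \<phi>)"
  using right_action_iff_left_inverse[of h S, OF assms]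
    left_action_iff[of "\<lambda>x. inv_into UNIV (h x)" S] bij_imp_bij_inv[OF assms] by simp

end

theory Submission imports Defs begin

text \<open>
  Involutivity of \<open>S (x, y) = (g x y, f y x)\<close> amounts to the two equations
  \<open>g (g x y) (f y x) = x\<close> and \<open>f (f y x) (g x y) = y\<close>, and everything is extracted from them.
  Write \<open>f'\<close> for the inverses of the maps \<open>f\<close>.

  The twisting identity comes from inverting \<open>f y \<circ> f x = f (f y x) \<circ> f (g x y)\<close> and
  evaluating at \<open>y\<close>: the left-hand side becomes \<open>f' x (T y)\<close>, while on the right \<open>f' (f y x)\<close>
  sends \<open>y\<close> to \<open>g x y\<close>, which leaves \<open>T (g x y)\<close>.

  If the maps \<open>g x\<close> are bijective as well, then \<open>T y = x\<close>, that is \<open>f y x = y\<close>, turns out to be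
  equivalent to \<open>g x y = x\<close>; so \<open>T\<close> is invertible, and its inverse is the same construction with
  \<open>g\<close> in place of \<open>f\<close>.
  Hence \<open>T\<close> conjugates \<open>g x\<close> to \<open>f' x\<close>. This transports the left action \<open>f'\<close> to the left
  action \<open>g\<close>, and a map intertwining two families on the generators intertwines the actions of
  the whole group, since these are evaluated word by word.

  The two sides of the braid equation on triples have three components. Equality of the first
  ones says that \<open>g\<close> is a left action, equality of the last ones that \<open>f\<close> is a right action, and
  equality of the middle ones is the linking relation. For the linking relation, put
  \<open>a = g x (g y z)\<close>: by involutivity and the left action property, the injective map \<open>g a\<close> takes
  both sides to \<open>g x y\<close>.
\<close>

section \<open>Extending intertwiners from generators to the structure group\<close>

lemma eval_word_intertwine:
  assumes "\<And>x. bij (h x)" "\<And>x. bij (k x)" and int: "\<And>x. t \<circ> h x = k x \<circ> t"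
  shows "t \<circ> eval_word h w = eval_word k w \<circ> t"
proof (induction w)
  case (Cons p w)
  have inv: "t (inv_into UNIV (h x) e) = inv_into UNIV (k x) (t e)" for x e
  proof -
    have "k x (t (inv_into UNIV (h x) e)) = t (h x (inv_into UNIV (h x) e))"
      using int[of x] by (simp add: fun_eq_iff)
    also have "\<dots> = t e"
      using assms(1) by (simp add: bij_is_surj surj_f_inv_f)
    finally show ?thesis
      using assms(2) by (metis bij_is_inj inv_f_f)
  qed
  show ?case
    using Cons.IH inv int by (simp add: fun_eq_iff)
qed simp

text \<open>
  An action of the structure group is determined by its generators: the letter \<open>(x, False)\<close> has
  to act by the inverse of \<open>h x\<close>, because it cancels against \<open>(x, True)\<close>.
\<close>

lemma extends_to_action_word_class:
  assumes "extends_to_action S h \<phi>"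
  shows "\<phi> (word_class S w) = eval_word h w"
proof -
  interpret A: group_action "structure_group S" UNIV \<phi>
    using assms by (simp add: extends_to_action_def)
  have gen: "\<phi> (word_class S [(x, True)]) = h x" for x
    using assms by (simp add: extends_to_action_def generator_def)
  have comp: "\<phi> (word_class S (u @ v)) = \<phi> (word_class S u) \<circ> \<phi> (word_class S v)" for u v
  proof
    fix e
    have "\<phi> (word_class S u \<otimes>\<^bsub>structure_group S\<^esub> word_class S v) e
        = \<phi> (word_class S u) (\<phi> (word_class S v) e)"
      by (rule A.composition_rule) (simp_all add: structure_group_carrier)
    then show "\<phi> (word_class S (u @ v)) e = (\<phi> (word_class S u) \<circ> \<phi> (word_class S v)) e"
      by (simp add: word_class_mult)
  qed
  have one: "\<phi> (word_class S []) = id"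
    using A.id_eq_one by (simp add: structure_group_one fun_eq_iff)
  have cancel: "\<phi> (word_class S [(x, b)]) \<circ> \<phi> (word_class S [(x, \<not> b)]) = id" for x b
  proof -
    have "word_class S [(x, b), (x, \<not> b)] = word_class S []"
      by (simp only: word_class_eq_iff word_eq.cancel)
    then show ?thesis
      using comp[of "[(x, b)]" "[(x, \<not> b)]"] one by simp
  qed
  have neg: "\<phi> (word_class S [(x, False)]) = inv_into UNIV (h x)" for x
    by (rule inv_unique_comp[symmetric])
      (use cancel[of x True] cancel[of x False] gen[of x] in simp_all)
  show ?thesis
  proof (induction w)
    case (Cons p w)
    obtain x b where "p = (x, b)" by force
    then show ?case
      using comp[of "[p]" w] Cons.IH gen neg by (cases b) simp_all
  qed (simp add: one)
qed

lemma isomorphic_actions_if_intertwine: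
  assumes "extends_to_action S h \<phi>" "extends_to_action S k \<psi>"
    and "\<And>x. bij (h x)" "\<And>x. bij (k x)" "bij t" "\<And>x. t \<circ> h x = k x \<circ> t"
  shows "isomorphic_actions (structure_group S) UNIV \<phi> UNIV \<psi>"
proof -
  have "t (\<phi> a e) = \<psi> a (t e)" if "a \<in> carrier (structure_group S)" for a e
    using that eval_word_intertwine[OF assms(3,4,6)]
    by (auto simp: structure_group_carrier fun_eq_iff
        extends_to_action_word_class[OF assms(1)] extends_to_action_word_class[OF assms(2)])
  then show ?thesis
    unfolding isomorphic_actions_def using assms(5) by blast
qed

section \<open>Involutive pairs and their component maps\<close>

context
  fixes S :: "'a \<times> 'a \<Rightarrow> 'a \<times> 'a" and f g :: "'a \<Rightarrow> 'a \<Rightarrow> 'a"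
  assumes S: "\<And>x y. S (x, y) = (g x y, f y x)"
begin

lemma involutive_iff:
  "involutive S \<longleftrightarrow> (\<forall>x y. g (g x y) (f y x) = x \<and> f (f y x) (g x y) = y)"
  by (auto simp: involutive_def fun_eq_iff S)

lemma nondegenerate_iff: "nondegenerate S \<longleftrightarrow> (\<forall>x. bij (f x)) \<and> (\<forall>x. bij (g x))"
  by (simp add: nondegenerate_def S)

lemma is_right_action_components_iff:
  "is_right_action S f \<longleftrightarrow>
     (\<forall>x. bij (f x)) \<and> (\<forall>x y e. f y (f x e) = f (f y x) (f (g x y) e))"
  by (auto simp: is_right_action_def S fun_eq_iff)

lemma is_left_action_components_iff:
  "is_left_action S g \<longleftrightarrow>
     (\<forall>x. bij (g x)) \<and> (\<forall>x y e. g x (g y e) = g (g x y) (g (f y x) e))"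
  by (auto simp: is_left_action_def S fun_eq_iff)

lemma braided_components_iff:
  "braided S \<longleftrightarrow> (\<forall>x y z. g x (g y z) = g (g x y) (g (f y x) z) \<and>
     f (g (f y x) z) (g x y) = g (f (g y z) x) (f z y) \<and>
     f z (f y x) = f (f z y) (f (g y z) x))"
  by (auto simp: braided_def S12_def S23_def fun_eq_iff S)

lemma fixed_point_iff:
  assumes "involutive S" "inj (f y)" "inj (g x)"
  shows "f y x = y \<longleftrightarrow> g x y = x"
proof
  assume "f y x = y"
  \<comment> \<open>Here \<open>S (x, y) = (g x y, y)\<close>; applying \<open>S\<close> again gives \<open>f y (g x y) = y = f y x\<close>.\<close>
  then have "f y (g x y) = f y x"
    using assms(1) by (metis involutive_iff)
  then show "g x y = x" using assms(2) by (simp add: inj_eq)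
next
  assume "g x y = x"
  then have "g x (f y x) = g x y"
    using assms(1) by (metis involutive_iff)
  then show "f y x = y" using assms(3) by (simp add: inj_eq)
qed

lemma twist_intertwines:
  assumes "involutive S" "is_right_action S f" and T: "\<And>y. T y = inv_into UNIV (f y) y"
  shows "inv_into UNIV (f x) \<circ> T = T \<circ> g x"
proof
  fix y
  have bij: "bij (f x)" for x
    using assms(2) by (simp add: is_right_action_components_iff)
  then have fT: "f y (T y) = y" for y
    by (simp add: T bij_is_surj surj_f_inv_f)
  \<comment> \<open>It suffices that \<open>f y \<circ> f x\<close> sends \<open>T (g x y)\<close> to \<open>y\<close>.\<close>
  have "f y (f x (T (g x y))) = f (f y x) (f (g x y) (T (g x y)))"
    using assms(2) by (simp only: is_right_action_components_iff)
  also have "\<dots> = y"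
    using assms(1) by (simp add: fT involutive_iff)
  finally have "f x (T (g x y)) = T y"
    using fT[of y] bij[of y] by (metis bij_is_inj injD)
  then show "(inv_into UNIV (f x) \<circ> T) y = (T \<circ> g x) y"
    using bij[of x] by (metis bij_is_inj comp_apply inv_f_f)
qed

text \<open>
  The fixed point criterion is symmetric in \<open>f\<close> and \<open>g\<close>, and so it exhibits \<open>x \<mapsto> inv (g x) x\<close>
  as a two-sided inverse of the twist.
\<close>

lemma bij_twist:
  assumes "nondegenerate S" "involutive S" and T: "\<And>y. T y = inv_into UNIV (f y) y"
  shows "bij T"
proof -
  have bij: "bij (f x)" "bij (g x)" for x
    using assms(1) by (simp_all add: nondegenerate_iff)
  have Tf: "T y = x \<longleftrightarrow> f y x = y" for x y
    unfolding T using bij(1)[of y] by (metis bij_inv_eq_iff)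
  have "T y = x \<longleftrightarrow> g x y = x" for x y
    using fixed_point_iff[OF assms(2)] bij by (simp add: Tf bij_is_inj)
  then have "T y = x \<longleftrightarrow> y = inv_into UNIV (g x) x" for x y
    using bij(2)[of x] by (metis bij_inv_eq_iff)
  then show ?thesis
    by (metis bijI')
qed

lemma left_action_if_right_action:
  assumes "nondegenerate S" "involutive S" "is_right_action S f"
  shows "is_left_action S g"
proof -
  define T where "T = (\<lambda>y. inv_into UNIV (f y) y)"
  have "bij T"
    by (rule bij_twist[OF assms(1,2)]) (simp add: T_def)
  have int: "T (g x e) = inv_into UNIV (f x) (T e)" for x e
    using twist_intertwines[OF assms(2,3), of T x] by (simp add: T_def fun_eq_iff)
  have "is_left_action S (\<lambda>x. inv_into UNIV (f x))"
    using assms(1,3) by (simp add: nondegenerate_iff right_action_iff_left_inverse)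
  then have "T (g x (g y e)) = T (g (g x y) (g (f y x) e))" for x y e
    by (simp add: int is_left_action_def S fun_eq_iff)
  then have "g x (g y e) = g (g x y) (g (f y x) e)" for x y e
    using \<open>bij T\<close> by (metis bij_is_inj injD)
  then show ?thesis
    using assms(1) by (simp add: is_left_action_components_iff nondegenerate_iff)
qed

text \<open>
  Both sides are middle components of triples whose first component is \<open>g x (g y z)\<close>, by the
  left action property. Applying \<open>g\<close> of that element undoes the last use of \<open>S\<close> on the left-hand
  side; on the right-hand side the left action property, read backwards, reduces to undoing the
  first one.
\<close>

lemma linking_relation:
  assumes "involutive S" "is_left_action S g"
  shows "f (g (f y x) z) (g x y) = g (f (g y z) x) (f z y)"
proof -
  have left: "g x (g y e) = g (g x y) (g (f y x) e)" for x y e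
    using assms(2) by (simp only: is_left_action_components_iff)
  have invol: "g (g x y) (f y x) = x" for x y
    using assms(1) by (simp add: involutive_iff)
  let ?a = "g x (g y z)"
  have "g ?a (f (g (f y x) z) (g x y)) = g x y"
    using invol[of "g x y" "g (f y x) z"] by (simp add: left[of x y z])
  moreover have "g ?a (g (f (g y z) x) (f z y)) = g x y"
    using left[of x "g y z" "f z y"] by (simp add: invol)
  moreover have "inj (g ?a)"
    using assms(2) by (simp add: is_left_action_def bij_is_inj)
  ultimately show ?thesis
    by (metis injD)
qed

lemma symmetric_set_iff_right_action:
  assumes "nondegenerate S" "involutive S"
  shows "symmetric_set S \<longleftrightarrow> is_right_action S f"
proof
  assume "symmetric_set S"
  then have "f z (f y x) = f (f z y) (f (g y z) x)" for x y z
    by (simp only: symmetric_set_def braided_components_iff)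
  then show "is_right_action S f"
    using assms(1) by (simp add: is_right_action_components_iff nondegenerate_iff)
next
  assume right: "is_right_action S f"
  have left: "is_left_action S g"
    by (rule left_action_if_right_action[OF assms right])
  have "braided S"
    unfolding braided_components_iff
  proof (intro allI conjI)
    fix x y z
    show "g x (g y z) = g (g x y) (g (f y x) z)"
      using left by (simp only: is_left_action_components_iff)
    show "f (g (f y x) z) (g x y) = g (f (g y z) x) (f z y)"
      by (rule linking_relation[OF assms(2) left])
    show "f z (f y x) = f (f z y) (f (g y z) x)"
      using right by (simp only: is_right_action_components_iff)
  qed
  then show "symmetric_set S"
    using assms(2) by (simp add: symmetric_set_def)
qed

text \<open>
  The twist maps the action of \<open>g\<close> to that of the inverses of \<open>f\<close>, so the isomorphism in the
  stated direction is its inverse.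
\<close>

lemma isomorphic_left_actions:
  assumes "nondegenerate S" "involutive S" "is_right_action S f"
  shows "\<exists>\<phi> \<psi>. extends_to_action S (\<lambda>x. inv_into UNIV (f x)) \<phi> \<and> extends_to_action S g \<psi> \<and>
           isomorphic_actions (structure_group S) UNIV \<phi> UNIV \<psi>"
proof -
  define T where "T = (\<lambda>y. inv_into UNIV (f y) y)"
  have "bij T"
    by (rule bij_twist[OF assms(1,2)]) (simp add: T_def)
  have int: "T (g x e) = inv_into UNIV (f x) (T e)" for x e
    using twist_intertwines[OF assms(2,3), of T x] by (simp add: T_def fun_eq_iff)
  have bij: "bij (f x)" "bij (g x)" for x
    using assms(1) by (simp_all add: nondegenerate_iff)
  obtain \<phi> where \<phi>: "extends_to_action S (\<lambda>x. inv_into UNIV (f x)) \<phi>"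
    using assms(3) right_action_iff[of f S, OF bij(1)] by blast
  obtain \<psi> where \<psi>: "extends_to_action S g \<psi>"
    using left_action_if_right_action[OF assms] left_action_iff[of g S, OF bij(2)] by blast
  have "inv_into UNIV T \<circ> inv_into UNIV (f x) = g x \<circ> inv_into UNIV T" for x
  proof
    fix e
    have "T (g x (inv_into UNIV T e)) = inv_into UNIV (f x) e"
      using \<open>bij T\<close> by (simp add: int bij_is_surj surj_f_inv_f)
    then show "(inv_into UNIV T \<circ> inv_into UNIV (f x)) e = (g x \<circ> inv_into UNIV T) e"
      using \<open>bij T\<close> by (metis bij_is_inj comp_apply inv_f_f)
  qed
  then have "isomorphic_actions (structure_group S) UNIV \<phi> UNIV \<psi>"
    by (intro isomorphic_actions_if_intertwine[OF \<phi> \<psi>, where t = "inv_into UNIV T"]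
        bij_imp_bij_inv bij \<open>bij T\<close>)
  with \<phi> \<psi> show ?thesis by blast
qed

end

theorem proposition2p2:
  fixes S :: "'a \<times> 'a \<Rightarrow> 'a \<times> 'a"
    and f g :: "'a \<Rightarrow> 'a \<Rightarrow> 'a"
    and T :: "'a \<Rightarrow> 'a"
  assumes S: "\<And>x y. S (x, y) = (g x y, f y x)"
    and T: "\<And>y. T y = inv_into UNIV (f y) y"
  shows
    "(involutive S \<and> (\<forall>x. bij (f x)) \<and> is_right_action S f
        \<longrightarrow> (\<forall>x. inv_into UNIV (f x) \<circ> T = T \<circ> g x))
     \<and> (nondegenerate S \<and> involutive S \<and> is_right_action S f
        \<longrightarrow> bij T \<and>
            (\<exists>\<phi> \<psi>. extends_to_action S (\<lambda>x. inv_into UNIV (f x)) \<phi> \<and>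
                   extends_to_action S g \<psi> \<and>
                   isomorphic_actions (structure_group S) UNIV \<phi> UNIV \<psi>))
     \<and> (nondegenerate S \<and> involutive S \<and> is_right_action S f
        \<longrightarrow> is_left_action S g \<and>
            (\<forall>x y z. f (g (f y x) z) (g x y) = g (f (g y z) x) (f z y)))
     \<and> (nondegenerate S \<and> involutive S
        \<longrightarrow> (symmetric_set S \<longleftrightarrow> is_right_action S f))"
  using twist_intertwines[of S g f T] bij_twist[of S g f T] isomorphic_left_actions[of S g f]
    left_action_if_right_action[of S g f] linking_relation[of S g f]
    symmetric_set_iff_right_action[of S g f]
  by (intro conjI impI allI; elim conjE) (simp_all add: S T)

end
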